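(* Consider the impulsive hybrid system with dwell time described in the context. Let $h:\mathcal{T}\times\mathcal{X}\to\mathbb{R}$ be an Impulsive Timed Control Barrier Function (ITCBF) for this system, with associated upper-bound function $\psi_h$, and let $\mathcal{S}_h(t)=\{x\in\mathcal{X}\mid h(t,x)\le 0\}$. Let $u:\mathcal{D}\times\mathcal{X}\to\mathcal{U}$ be a control law and let $\mathcal{Z}_{\mathrm{coast}}=\{(t,\sigma,x)\in\mathcal{D}\times\mathcal{X}\mid u(t,\sigma,x)=0\}$. Suppose that (a) $\psi_h(t+\Delta t,\,t,\,x)\le 0$ for all $(t,\sigma,x)\in(\mathcal{D}\times\mathcal{S}_h)\cap\mathcal{Z}_{\mathrm{coast}}$, and (b) $\psi_h(t+\Delta T,\,t,\,g(t,x,u(t,\sigma,x)))\le 0$ for all $(t,\sigma,x)\in(\mathcal{D}\times\mathcal{S}_h)\setminus\mathcal{Z}_{\mathrm{coast}}$, where $\mathcal{D}\times\mathcal{S}_h$ denotes $\{(t,\sigma,x)\mid (t,\sigma)\in\mathcal{D},\ x\in\mathcal{S}_h(t)\}$. Then $u$ renders the time-varying set $\mathcal{S}_h(t)$ forward invariant for all $t\in\mathcal{T}$; that is, if $x(t_0)\in\mathcal{S}_h(t_0)$, then the closed-loop trajectory satisfies $x(t)\in\mathcal{S}_h(t)$ for all $t\in\mathcal{T}$, $t\ge t_0$.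
   Context: **System.** Let $\mathcal{T}\subseteq\mathbb{R}$ be a time domain, $\mathcal{X}\subseteq\mathbb{R}^n$ the state space, $\mathcal{U}\subseteq\mathbb{R}^m$ the set of allowable controls, and $t_0\in\mathcal{T}$ the initial time. Let $\mathbb{N}$ be the nonnegative integers. Let $\Delta t>0$ (the sampling period) and $\Delta T>\Delta t$ (the minimum dwell time between impulses) be fixed, with $\Delta T=q\Delta t$ for some $q\in\mathbb{N}$. The state $\sigma\in\mathbb{R}_{\ge0}$ records the time since the last impulse. Define $$\mathcal{D}_0=\{t\in\mathcal{T}\mid t=t_0+k\Delta t,\ k\in\mathbb{N}\},\qquad \mathcal{D}=\mathcal{D}_0\times\{\sigma\in\mathbb{R}_{\ge 0}\mid\sigma\ge\Delta T\}.$$ A pair $(t,\sigma)\in\mathcal{D}$ is called an impulse opportunity. A control law is a map $u:\mathcal{D}\times\mathcal{X}\to\mathcal{U}$. The system is $$\begin{cases}\dot x=f(t,x),\ \ \dot\sigma=1, & (t,\sigma)\notin\mathcal{D},\\ x^+=g(t,x,u),\ \ \sigma^+=\sigma\text{ if }u=0,\ \ \sigma^+=0\text{ if }u\ne0, & (t,\sigma)\in\mathcal{D},\end{cases}$$ with $f:\mathcal{T}\times\mathcal{X}\to\mathbb{R}^n$ and $g:\mathcal{T}\times\mathcal{X}\times\mathcal{U}\to\mathcal{X}$. At each impulse opportunity the jump is executed once, using $u=u(t,\sigma,x)$, and then the state flows until the next impulse opportunity, which is at time $t+\Delta t$ if $u(t,\sigma,x)=0$ and at time $t+\Delta T$ if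 $u(t,\sigma,x)\neq 0$. **Standing assumptions.** $f$ and $g$ are known and single-valued; $g(t,x,0)=x$ for all $t\in\mathcal{T},x\in\mathcal{X}$; solutions of the system exist and are unique for all $t\in\mathcal{T}$; and $\sigma(t_0)=\Delta T$, so that the initial condition is an impulse opportunity. **Flow operator.** $p(\tau,t,x)=y(\tau)$, where $\dot y(s)=f(s,y(s))$, $y(t)=x$ (evolution with no jumps on $[t,\tau]$). **Upper-bound function.** For $h:\mathcal{T}\times\mathcal{X}\to\mathbb{R}$, $\psi_h:\mathcal{T}\times\mathcal{T}\times\mathcal{X}\to\mathbb{R}$ denotes any (fixed) function satisfying $\psi_h(\tau,t,x)\ge h(s,p(s,t,x))$ for all $s\in[t,\tau]$. **ITCBF.** A continuous function $h:\mathcal{T}\times\mathcal{X}\to\mathbb{R}$ is an Impulsive Timed Control Barrier Function for the system (with respect to such a $\psi_h$) if $$\inf_{u\in\mathcal{U}}\psi_h(t+\Delta T,\,t,\,g(t,x,u))\le0\quad\text{for all }x\in\mathcal{S}_h(t)\text{ and all }t\in\mathcal{T}.$$ *)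

theory Defs
  imports "HOL-Analysis.Analysis"
begin

definition sample_times :: "real set \<Rightarrow> real \<Rightarrow> real \<Rightarrow> real set" where
  "sample_times T t0 dt = {t \<in> T. \<exists>k::nat. t = t0 + real k * dt}"

definition impulse_opportunities ::
    "real set \<Rightarrow> real \<Rightarrow> real \<Rightarrow> real \<Rightarrow> (real \<times> real) set" where
  "impulse_opportunities T t0 dt dT = sample_times T t0 dt \<times> {\<sigma>. 0 \<le> \<sigma> \<and> dT \<le> \<sigma>}"

text \<open>Classical solutions on a compact interval, with one-sided derivatives at its end points.\<close>

definition flow_solution ::
    "(real \<Rightarrow> 'a \<Rightarrow> 'a) \<Rightarrow> 'a::real_normed_vector set \<Rightarrow> real \<Rightarrow> real \<Rightarrow> (real \<Rightarrow> 'a) \<Rightarrow> bool" where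
  "flow_solution f X a b y \<longleftrightarrow>
     (\<forall>s\<in>{a..b}. y s \<in> X \<and> (y has_vector_derivative f s (y s)) (at s within {a..b}))"

definition unique_flows ::
    "real set \<Rightarrow> 'a::real_normed_vector set \<Rightarrow> (real \<Rightarrow> 'a \<Rightarrow> 'a) \<Rightarrow> bool" where
  "unique_flows T X f \<longleftrightarrow>
     (\<forall>t\<in>T. \<forall>\<tau>\<in>T. \<forall>x\<in>X. t \<le> \<tau> \<longrightarrow>
        (\<exists>y. flow_solution f X t \<tau> y \<and> y t = x) \<and>
        (\<forall>y z. flow_solution f X t \<tau> y \<and> y t = x \<and> flow_solution f X t \<tau> z \<and> z t = x
           \<longrightarrow> (\<forall>s\<in>{t..\<tau>}. y s = z s)))"

text \<open>The description is only meaningful under \<open>unique_flows\<close>.\<close>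

definition flow_op ::
    "(real \<Rightarrow> 'a \<Rightarrow> 'a) \<Rightarrow> 'a::real_normed_vector set \<Rightarrow> real \<Rightarrow> real \<Rightarrow> 'a \<Rightarrow> 'a" where
  "flow_op f X \<tau> t x = (THE z. \<exists>y. flow_solution f X t \<tau> y \<and> y t = x \<and> y \<tau> = z)"

text \<open>
  The end time \<open>\<tau>\<close> is not required to lie in \<open>T\<close>: the conditions on \<open>\<psi>\<close> below use
  \<open>\<tau> = t + dt\<close> and \<open>\<tau> = t + dT\<close>, which leave \<open>T\<close> near the right end of a bounded time domain.
  There the bound concerns the part of \<open>[t, \<tau>]\<close> inside \<open>T\<close>; for an interval \<open>T\<close> and \<open>\<tau> \<in> T\<close>
  this is all of \<open>[t, \<tau>]\<close>.
\<close>

definition upper_bound_function ::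
    "real set \<Rightarrow> 'a::real_normed_vector set \<Rightarrow> (real \<Rightarrow> 'a \<Rightarrow> 'a) \<Rightarrow> (real \<Rightarrow> 'a \<Rightarrow> real) \<Rightarrow>
     (real \<Rightarrow> real \<Rightarrow> 'a \<Rightarrow> real) \<Rightarrow> bool" where
  "upper_bound_function T X f h \<psi> \<longleftrightarrow>
     (\<forall>\<tau>. \<forall>t\<in>T. \<forall>x\<in>X. \<forall>s\<in>{t..\<tau>} \<inter> T. h s (flow_op f X s t x) \<le> \<psi> \<tau> t x)"

definition safe_set :: "'a set \<Rightarrow> (real \<Rightarrow> 'a \<Rightarrow> real) \<Rightarrow> real \<Rightarrow> 'a set" where
  "safe_set X h t = {x \<in> X. h t x \<le> 0}"

text \<open>The infimum is taken in the extended reals, since \<open>\<psi>\<close> need not be bounded below over \<open>U\<close>.\<close>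

definition itcbf ::
    "real set \<Rightarrow> 'a::real_normed_vector set \<Rightarrow> 'b set \<Rightarrow> real \<Rightarrow> (real \<Rightarrow> 'a \<Rightarrow> 'b \<Rightarrow> 'a) \<Rightarrow>
     (real \<Rightarrow> real \<Rightarrow> 'a \<Rightarrow> real) \<Rightarrow> (real \<Rightarrow> 'a \<Rightarrow> real) \<Rightarrow> bool" where
  "itcbf T X U dT g \<psi> h \<longleftrightarrow>
     continuous_on (T \<times> X) (\<lambda>(t, x). h t x) \<and>
     (\<forall>t\<in>T. \<forall>x\<in>safe_set X h t. (INF v\<in>U. ereal (\<psi> (t + dT) t (g t x v))) \<le> 0)"

definition coast_set ::
    "(real \<times> real) set \<Rightarrow> 'a set \<Rightarrow> (real \<Rightarrow> real \<Rightarrow> 'a \<Rightarrow> 'b::zero) \<Rightarrow> (real \<times> real \<times> 'a) set" where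
  "coast_set D X u = {(t, \<sigma>, x). (t, \<sigma>) \<in> D \<and> x \<in> X \<and> u t \<sigma> x = 0}"

definition safe_opportunities ::
    "(real \<times> real) set \<Rightarrow> 'a set \<Rightarrow> (real \<Rightarrow> 'a \<Rightarrow> real) \<Rightarrow> (real \<times> real \<times> 'a) set" where
  "safe_opportunities D X h = {(t, \<sigma>, x). (t, \<sigma>) \<in> D \<and> x \<in> safe_set X h t}"

text \<open>The values \<open>x\<^sup>+\<close> and \<open>\<sigma>\<^sup>+\<close> at time \<open>t\<close>; they equal \<open>x\<close> and \<open>\<sigma>\<close> outside \<open>D\<close>.\<close>

definition post_state ::
    "(real \<times> real) set \<Rightarrow> (real \<Rightarrow> 'a \<Rightarrow> 'b \<Rightarrow> 'a) \<Rightarrow> (real \<Rightarrow> real \<Rightarrow> 'a \<Rightarrow> 'b) \<Rightarrow>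
     real \<Rightarrow> real \<Rightarrow> 'a \<Rightarrow> 'a" where
  "post_state D g u t \<sigma> x = (if (t, \<sigma>) \<in> D then g t x (u t \<sigma> x) else x)"

definition post_timer ::
    "(real \<times> real) set \<Rightarrow> (real \<Rightarrow> real \<Rightarrow> 'a \<Rightarrow> 'b::zero) \<Rightarrow> real \<Rightarrow> real \<Rightarrow> 'a \<Rightarrow> real" where
  "post_timer D u t \<sigma> x = (if (t, \<sigma>) \<in> D \<and> u t \<sigma> x \<noteq> 0 then 0 else \<sigma>)"

text \<open>
  \<open>x t\<close> and \<open>\<sigma> t\<close> are the values before the jump, if any, at time \<open>t\<close>. Each jump is executed
  once: on \<open>[a, b]\<close> with no impulse opportunity strictly between \<open>a\<close> and \<open>b\<close>, state and timer
  flow from their values after the jump at \<open>a\<close>. That the next opportunity after one at \<open>t\<close> is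
  \<open>t + dt\<close> (no impulse) or \<open>t + dT\<close> (impulse) is a consequence of the dynamics of \<open>\<sigma>\<close>.
\<close>

definition closed_loop_trajectory ::
    "real set \<Rightarrow> 'a::real_normed_vector set \<Rightarrow> real \<Rightarrow> real \<Rightarrow> real \<Rightarrow> (real \<Rightarrow> 'a \<Rightarrow> 'a) \<Rightarrow>
     (real \<Rightarrow> 'a \<Rightarrow> 'b \<Rightarrow> 'a) \<Rightarrow> (real \<Rightarrow> real \<Rightarrow> 'a \<Rightarrow> 'b::zero) \<Rightarrow> (real \<Rightarrow> 'a) \<Rightarrow> (real \<Rightarrow> real) \<Rightarrow> bool"
  where
  "closed_loop_trajectory T X t0 dt dT f g u x \<sigma> \<longleftrightarrow>
     (let D = impulse_opportunities T t0 dt dT in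
      x t0 \<in> X \<and> \<sigma> t0 = dT \<and>
      (\<forall>a\<in>T. \<forall>b\<in>T. t0 \<le> a \<and> a < b \<and> (\<forall>s\<in>{a<..<b}. (s, \<sigma> s) \<notin> D) \<longrightarrow>
         flow_solution f X a b (\<lambda>s. if s = a then post_state D g u a (\<sigma> a) (x a) else x s) \<and>
         flow_solution (\<lambda>_ _. 1) {0..} a b
           (\<lambda>s. if s = a then post_timer D u a (\<sigma> a) (x a) else \<sigma> s)))"

text \<open>At a jump time, both the value before and the value after the jump have to lie in the set.\<close>

definition renders_forward_invariant ::
    "real set \<Rightarrow> 'a::real_normed_vector set \<Rightarrow> real \<Rightarrow> real \<Rightarrow> real \<Rightarrow> (real \<Rightarrow> 'a \<Rightarrow> 'a) \<Rightarrow>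
     (real \<Rightarrow> 'a \<Rightarrow> 'b \<Rightarrow> 'a) \<Rightarrow> (real \<Rightarrow> real \<Rightarrow> 'a \<Rightarrow> 'b::zero) \<Rightarrow> (real \<Rightarrow> 'a set) \<Rightarrow> bool" where
  "renders_forward_invariant T X t0 dt dT f g u S \<longleftrightarrow>
     (\<forall>x \<sigma>. closed_loop_trajectory T X t0 dt dT f g u x \<sigma> \<and> x t0 \<in> S t0 \<longrightarrow>
        (\<forall>t\<in>T. t0 \<le> t \<longrightarrow>
           x t \<in> S t \<and>
           post_state (impulse_opportunities T t0 dt dT) g u t (\<sigma> t) (x t) \<in> S t))"

end

theory Submission
  imports Defs
begin

text \<open>
  Between two consecutive impulse opportunities \<open>a < a + \<delta>\<close> the closed loop flows from the
  post-jump state at \<open>a\<close>, so \<open>\<psi> (a + \<delta>) a\<close> of that state being nonpositive keeps \<open>h \<le> 0\<close> there;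
  (a) and (b) say this for \<open>\<delta> = dt\<close> and \<open>\<delta> = dT\<close>. That \<open>\<delta>\<close> is the right step follows from the
  timer: it exceeds \<open>dT\<close> after a coast, and runs from \<open>0\<close> to \<open>dT\<close> after an impulse. As
  \<open>\<delta> \<ge> dt\<close>, finitely many steps reach any given time.
\<close>

section \<open>Flow operator and unit-speed timer\<close>

text \<open>All solutions from \<open>x\<close> agree at \<open>\<tau>\<close> by uniqueness, so the
  definite description has exactly one witness and any solution at hand computes it.\<close>

lemma flow_op_eq:
  assumes "unique_flows T X f" "t \<in> T" "\<tau> \<in> T" "t \<le> \<tau>" "x \<in> X"
    and "flow_solution f X t \<tau> y" "y t = x"
  shows "flow_op f X \<tau> t x = y \<tau>"
proof -
  have uniq: "\<forall>s\<in>{t..\<tau>}. y' s = z s" if "flow_solution f X t \<tau> y'" "y' t = x"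
    "flow_solution f X t \<tau> z" "z t = x" for y' z
    using assms(1-5) that unfolding unique_flows_def by blast
  have "z = y \<tau>" if "flow_solution f X t \<tau> w \<and> w t = x \<and> w \<tau> = z" for z w
    using uniq[of w y] assms(4,6,7) that by auto
  with assms(6,7) show ?thesis
    unfolding flow_op_def by (intro the_equality) blast+
qed

text \<open>Turns the bound by \<open>\<psi>\<close> at the left end of its interval into a bound on
  \<open>h\<close> at the initial state itself, which is how a post-jump state is seen to be
  safe.\<close>

lemma flow_op_refl:
  assumes "unique_flows T X f" "t \<in> T" "x \<in> X"
  shows "flow_op f X t t x = x"
proof -
  obtain y where "flow_solution f X t t y" "y t = x"
    using assms unfolding unique_flows_def by blast
  then show ?thesis
    using flow_op_eq[OF assms(1,2,2) order_refl assms(3)] by simp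
qed

lemma flow_solution_unit_speed:
  assumes "flow_solution (\<lambda>_ _. 1) S a b (y :: real \<Rightarrow> real)" "a \<le> b"
  shows "y b = y a + (b - a)"
proof -
  have "((\<lambda>_. 1) has_integral y b - y a) {a..b}"
    using assms unfolding flow_solution_def by (intro fundamental_theorem_of_calculus) auto
  then have "y b - y a = b - a"
    using has_integral_unique[OF _ has_integral_const_real[of "1::real" a b]] assms(2) by simp
  then show ?thesis by simp
qed

section \<open>Arithmetic of the sampling grid\<close>

text \<open>Both times lie a whole number of periods after \<open>t0\<close>, so a strict bound
  improves by a full period. With \<open>j = 0\<close>, no sample time lies strictly between
  \<open>a\<close> and \<open>a + dt\<close>.\<close>

lemma sample_times_gap:
  assumes "a \<in> sample_times T t0 dt" "r \<in> sample_times T t0 dt" "0 < dt"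
    and "r < a + real (Suc j) * dt"
  shows "r \<le> a + real j * dt"
proof -
  obtain k i where ki: "a = t0 + real k * dt" "r = t0 + real i * dt"
    using assms(1,2) unfolding sample_times_def by blast
  have "real i * dt < real (k + Suc j) * dt"
    using assms(4) ki by (simp add: algebra_simps)
  then have "real i < real (k + Suc j)"
    using assms(3) by (simp only: mult_less_cancel_right_pos)
  then have "i \<le> k + j" by linarith
  then have "real i * dt \<le> real (k + j) * dt"
    using assms(3) by (intro mult_right_mono) auto
  then show ?thesis using ki by (simp add: algebra_simps)
qed

lemma sample_times_shift:
  assumes "a \<in> sample_times T t0 dt" "a + real j * dt \<in> T"
  shows "a + real j * dt \<in> sample_times T t0 dt"
proof -
  obtain k where "a = t0 + real k * dt"
    using assms(1) unfolding sample_times_def by blast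
  then have "a + real j * dt = t0 + real (k + j) * dt"
    by (simp add: algebra_simps)
  with assms(2) show ?thesis unfolding sample_times_def by blast
qed

lemma opportunity_ge_start:
  assumes "(a, \<sigma>) \<in> impulse_opportunities T t0 dt dT" "0 < dt"
  shows "t0 \<le> a"
  using assms unfolding impulse_opportunities_def sample_times_def by auto

section \<open>Closed-loop trajectories between impulse opportunities\<close>

context
  fixes T :: "real set" and X :: "'a::real_normed_vector set" and t0 dt dT f g
    and u :: "real \<Rightarrow> real \<Rightarrow> 'a \<Rightarrow> 'b::zero" and x \<sigma>
  assumes dt: "0 < dt"
    and traj: "closed_loop_trajectory T X t0 dt dT f g u x \<sigma>"
begin

abbreviation (input) "opps \<equiv> impulse_opportunities T t0 dt dT"

lemma trajectory_flow:
  assumes "a \<in> T" "b \<in> T" "t0 \<le> a" "a < b" "\<And>s. a < s \<Longrightarrow> s < b \<Longrightarrow> (s, \<sigma> s) \<notin> opps"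
  shows "flow_solution f X a b (\<lambda>s. if s = a then post_state opps g u a (\<sigma> a) (x a) else x s)"
    and "flow_solution (\<lambda>_ _. 1) {0..} a b
           (\<lambda>s. if s = a then post_timer opps u a (\<sigma> a) (x a) else \<sigma> s)"
  using assms(3-5)
    bspec[OF bspec[OF conjunct2[OF conjunct2[OF traj[unfolded closed_loop_trajectory_def Let_def]]]
      assms(1)] assms(2)]
  by (meson greaterThanLessThan_iff)+

lemma trajectory_timer:
  assumes "a \<in> T" "b \<in> T" "t0 \<le> a" "a < b" "\<And>s. a < s \<Longrightarrow> s < b \<Longrightarrow> (s, \<sigma> s) \<notin> opps"
  shows "\<sigma> b = post_timer opps u a (\<sigma> a) (x a) + (b - a)"
  using flow_solution_unit_speed[OF trajectory_flow(2)[OF assms]] assms(4) by simp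

text \<open>The grid alone forces this, whatever the timer or the control does; it serves the
  coasting case.\<close>

lemma no_opportunity_before_dt:
  assumes "(a, \<sigma> a) \<in> opps" "a < s" "s < a + dt"
  shows "(s, \<sigma> s) \<notin> opps"
  using sample_times_gap[of a T t0 dt s 0] assms dt unfolding impulse_opportunities_def by auto

text \<open>There is an apparent circularity: the timer formula on \<open>(a, s]\<close> needs the
  absence of opportunities before \<open>s\<close>, which in turn comes from the timer being below
  \<open>dT\<close> there. Induction over the grid periods elapsed since \<open>a\<close> resolves
  it.\<close>

lemma timer_after_impulse:
  assumes a: "(a, \<sigma> a) \<in> opps" and imp: "u a (\<sigma> a) (x a) \<noteq> 0"
    and s: "s \<in> T" "a < s" "s \<le> a + dT"
  shows "\<sigma> s = s - a"
proof -
  have "\<sigma> s = s - a" if "s \<in> T" "a < s" "s \<le> a + dT" "s \<le> a + real j * dt" for j s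
    using that
  proof (induction j arbitrary: s)
    case 0
    then show ?case by simp
  next
    case (Suc j)
    have noopp: "(r, \<sigma> r) \<notin> opps" if r: "a < r" "r < s" for r
    proof
      assume opp: "(r, \<sigma> r) \<in> opps"
      \<comment> \<open>An opportunity is a sample time, so \<open>r\<close> falls back into the
        range of the induction hypothesis, which gives
        \<open>\<sigma> r = r - a < dT\<close>.\<close>
      have "r \<le> a + real j * dt"
        using a opp r Suc.prems(4) dt
        by (intro sample_times_gap[of _ T t0]) (auto simp: impulse_opportunities_def)
      moreover have "r \<in> T" "dT \<le> \<sigma> r"
        using opp by (auto simp: impulse_opportunities_def sample_times_def)
      ultimately show False
        using Suc.IH[of r] r Suc.prems(3) by simp
    qed
    have "a \<in> T"
      using a by (simp add: impulse_opportunities_def sample_times_def)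
    then show ?case
      using trajectory_timer[OF _ Suc.prems(1) opportunity_ge_start[OF a dt] Suc.prems(2) noopp]
        a imp by (simp add: post_timer_def)
  qed
  moreover obtain j where "(s - a) / dt < real j"
    using reals_Archimedean2 by blast
  then have "s \<le> a + real j * dt"
    using dt by (simp add: field_simps)
  ultimately show ?thesis using s by blast
qed

text \<open>On \<open>(a, t]\<close> the trajectory is the flow of the post-jump state, to which the
  bound by \<open>\<psi>\<close> applies. Allowing \<open>t = a + \<delta>\<close> covers the state
  just before the next jump; \<open>a + \<delta>\<close> itself may lie outside
  \<open>T\<close>.\<close>

lemma safe_until_next_opportunity:
  assumes "unique_flows T X f" and ub: "upper_bound_function T X f h \<psi>"
    and a: "(a, \<sigma> a) \<in> opps"
    and noopp: "\<And>s. s \<in> T \<Longrightarrow> a < s \<Longrightarrow> s < a + \<delta> \<Longrightarrow> (s, \<sigma> s) \<notin> opps"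
    and post: "post_state opps g u a (\<sigma> a) (x a) \<in> X"
    and \<psi>: "\<psi> (a + \<delta>) a (post_state opps g u a (\<sigma> a) (x a)) \<le> 0"
    and t: "t \<in> T" "a < t" "t \<le> a + \<delta>"
  shows "x t \<in> safe_set X h t"
proof -
  let ?p = "post_state opps g u a (\<sigma> a) (x a)"
  let ?y = "\<lambda>s. if s = a then ?p else x s"
  have aT: "a \<in> T"
    using a by (simp add: impulse_opportunities_def sample_times_def)
  have "(s, \<sigma> s) \<notin> opps" if "a < s" "s < t" for s
    using noopp[of s] that t by (auto simp: impulse_opportunities_def sample_times_def)
  then have fl: "flow_solution f X a t ?y"
    using trajectory_flow(1)[OF aT t(1) opportunity_ge_start[OF a dt] t(2)] by blast
  have "flow_op f X t a ?p = x t"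
    using flow_op_eq[OF assms(1) aT t(1) _ post fl] t by simp
  moreover have "h t (flow_op f X t a ?p) \<le> \<psi> (a + \<delta>) a ?p"
    using ub aT t post unfolding upper_bound_function_def by auto
  moreover have "x t \<in> X"
    using fl t unfolding flow_solution_def by (auto dest: bspec[of _ _ t])
  ultimately show ?thesis
    using \<psi> by (simp add: safe_set_def)
qed

end

section \<open>Forward invariance by stepping through the opportunities\<close>

theorem theorem1:
  fixes T :: "real set"
    and X :: "(real ^ 'n) set"
    and U :: "(real ^ 'm) set"
    and t0 dt dT :: real
    and f :: "real \<Rightarrow> real ^ 'n \<Rightarrow> real ^ 'n"
    and g :: "real \<Rightarrow> real ^ 'n \<Rightarrow> real ^ 'm \<Rightarrow> real ^ 'n"
    and h :: "real \<Rightarrow> real ^ 'n \<Rightarrow> real"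
    and \<psi> :: "real \<Rightarrow> real \<Rightarrow> real ^ 'n \<Rightarrow> real"
    and u :: "real \<Rightarrow> real \<Rightarrow> real ^ 'n \<Rightarrow> real ^ 'm"
    and D :: "(real \<times> real) set"
  defines "D \<equiv> impulse_opportunities T t0 dt dT"
  assumes "is_interval T" and "t0 \<in> T"
    and "0 < dt" and "dt < dT" and "\<exists>q::nat. dT = real q * dt"
    and "\<And>t x v. t \<in> T \<Longrightarrow> x \<in> X \<Longrightarrow> v \<in> U \<Longrightarrow> g t x v \<in> X"
    and "\<And>t x. t \<in> T \<Longrightarrow> x \<in> X \<Longrightarrow> g t x 0 = x"
    and "unique_flows T X f"
    and "upper_bound_function T X f h \<psi>"
    and "itcbf T X U dT g \<psi> h"
    and "\<And>t \<sigma> x. (t, \<sigma>) \<in> D \<Longrightarrow> x \<in> X \<Longrightarrow> u t \<sigma> x \<in> U"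
    and "\<forall>(t, \<sigma>, x) \<in> safe_opportunities D X h \<inter> coast_set D X u. \<psi> (t + dt) t x \<le> 0"
    and "\<forall>(t, \<sigma>, x) \<in> safe_opportunities D X h - coast_set D X u.
           \<psi> (t + dT) t (g t x (u t \<sigma> x)) \<le> 0"
  shows "renders_forward_invariant T X t0 dt dT f g u (safe_set X h)"
  unfolding renders_forward_invariant_def
proof (intro allI impI ballI; elim conjE)
  fix x \<sigma> t
  assume traj: "closed_loop_trajectory T X t0 dt dT f g u x \<sigma>"
    and x0: "x t0 \<in> safe_set X h t0" and tT: "t \<in> T" "t0 \<le> t"
  note ivl = assms(2) and dt = assms(4) and uf = assms(9) and ub = assms(10)
  let ?post = "\<lambda>s. post_state D g u s (\<sigma> s) (x s)"
  let ?safe = "\<lambda>s. x s \<in> safe_set X h s \<and> ?post s \<in> safe_set X h s"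
  obtain q :: nat where q: "dT = real q * dt"
    using assms(6) by blast
  have \<sigma>0: "\<sigma> t0 = dT"
    using traj by (simp add: closed_loop_trajectory_def Let_def)
  \<comment> \<open>The interval is half-open because the value after the jump at
    \<open>a + \<delta>\<close> is settled only by the next step; the value before that jump is
    passed on as its starting point.\<close>
  have step: "\<exists>\<delta>\<ge>dt. (\<forall>s\<in>T. a \<le> s \<and> s < a + \<delta> \<longrightarrow> ?safe s) \<and>
      (a + \<delta> \<in> T \<longrightarrow> (a + \<delta>, \<sigma> (a + \<delta>)) \<in> D \<and> x (a + \<delta>) \<in> safe_set X h (a + \<delta>))"
    if a: "(a, \<sigma> a) \<in> D" and xa: "x a \<in> safe_set X h a" for a
  proof -
    have aT: "a \<in> T" and as: "a \<in> sample_times T t0 dt" and \<sigma>a: "0 \<le> \<sigma> a" "dT \<le> \<sigma> a"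
      using a by (auto simp: D_def impulse_opportunities_def sample_times_def)
    have xX: "x a \<in> X"
      using xa by (simp add: safe_set_def)
    have pX: "?post a \<in> X"
      using a xX assms(7)[OF aT xX assms(12)[OF a xX]] by (simp add: post_state_def)
    define \<delta> where "\<delta> = (if u a (\<sigma> a) (x a) = 0 then dt else dT)"
    have \<delta>: "dt \<le> \<delta>"
      using assms(5) by (simp add: \<delta>_def)
    have \<psi>: "\<psi> (a + \<delta>) a (?post a) \<le> 0"
    proof (cases "u a (\<sigma> a) (x a) = 0")
      case True
      then have "(a, \<sigma> a, x a) \<in> safe_opportunities D X h \<inter> coast_set D X u"
        using a xa xX by (simp add: safe_opportunities_def coast_set_def)
      then have "\<psi> (a + dt) a (x a) \<le> 0"
        using assms(13) by blast
      \<comment> \<open>Since \<open>g\<close> fixes the state under zero control,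
        \<open>?post a\<close> is \<open>x a\<close>, the state that (a) speaks of.\<close>
      then show ?thesis
        using True a assms(8)[OF aT xX] by (simp add: \<delta>_def post_state_def)
    next
      case False
      then have "(a, \<sigma> a, x a) \<in> safe_opportunities D X h - coast_set D X u"
        using a xa xX by (simp add: safe_opportunities_def coast_set_def)
      then have "\<psi> (a + dT) a (g a (x a) (u a (\<sigma> a) (x a))) \<le> 0"
        using assms(14) by blast
      then show ?thesis
        using False a by (simp add: \<delta>_def post_state_def)
    qed
    have noopp: "(s, \<sigma> s) \<notin> D" if s: "s \<in> T" "a < s" "s < a + \<delta>" for s
    proof (cases "u a (\<sigma> a) (x a) = 0")
      case True
      then show ?thesis
        using no_opportunity_before_dt[OF dt traj a[unfolded D_def]] s by (simp add: \<delta>_def D_def)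
    next
      case False
      then have "\<sigma> s < dT"
        using timer_after_impulse[OF dt traj a[unfolded D_def]] s by (simp add: \<delta>_def)
      then show ?thesis
        by (simp add: D_def impulse_opportunities_def)
    qed
    have flow_safe: "x s \<in> safe_set X h s" if "s \<in> T" "a < s" "s \<le> a + \<delta>" for s
      using safe_until_next_opportunity[OF dt traj uf ub a[unfolded D_def]
          noopp[unfolded D_def] pX[unfolded D_def] \<psi>[unfolded D_def]] that by blast
    have "h a (flow_op f X a a (?post a)) \<le> \<psi> (a + \<delta>) a (?post a)"
      using ub aT pX \<delta> dt unfolding upper_bound_function_def by auto
    then have "?post a \<in> safe_set X h a"
      using flow_op_refl[OF uf aT pX] \<psi> pX by (simp add: safe_set_def)
    moreover have "?safe s" if "s \<in> T" "a < s" "s < a + \<delta>" for s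
      using flow_safe[of s] noopp[OF that] that by (simp add: post_state_def)
    ultimately have "?safe s" if "s \<in> T" "a \<le> s" "s < a + \<delta>" for s
      using xa that by (cases "s = a") auto
    moreover have "(a + \<delta>, \<sigma> (a + \<delta>)) \<in> D \<and> x (a + \<delta>) \<in> safe_set X h (a + \<delta>)"
      if n: "a + \<delta> \<in> T"
    proof -
      \<comment> \<open>One period after a coast, \<open>q\<close> periods after an impulse.\<close>
      have "\<exists>j::nat. \<delta> = real j * dt"
        using q by (cases "u a (\<sigma> a) (x a) = 0") (auto simp: \<delta>_def intro: exI[of _ "1::nat"])
      then have ns: "a + \<delta> \<in> sample_times T t0 dt"
        using sample_times_shift[OF as] n by blast
      \<comment> \<open>After a coast the timer grows from a value already at least
        \<open>dT\<close>; after an impulse it has just reached \<open>dT\<close>, which the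
        non-strict condition in \<open>D\<close> admits.\<close>
      have "dT \<le> \<sigma> (a + \<delta>)"
      proof (cases "u a (\<sigma> a) (x a) = 0")
        case True
        have "(s, \<sigma> s) \<notin> D" if "a < s" "s < a + \<delta>" for s
          using noopp[of s] that by (auto simp: D_def impulse_opportunities_def sample_times_def)
        then have "\<sigma> (a + \<delta>) = post_timer D u a (\<sigma> a) (x a) + \<delta>"
          using trajectory_timer[OF dt traj aT n opportunity_ge_start[OF a[unfolded D_def] dt]]
            \<delta> dt by (simp add: D_def)
        then show ?thesis
          using True \<sigma>a \<delta> dt by (simp add: post_timer_def)
      next
        case False
        then show ?thesis
          using timer_after_impulse[OF dt traj a[unfolded D_def] False n] \<delta> dt
          by (simp add: \<delta>_def)
      qed
      then show ?thesis
        using ns flow_safe[OF n] \<delta> dt assms(5)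
        by (simp add: D_def impulse_opportunities_def)
    qed
    ultimately show ?thesis
      using \<delta> by blast
  qed
  \<comment> \<open>Here \<open>n\<close> bounds the remaining time in periods. Every step uses up
    at least one period, hence the induction on \<open>n\<close> with \<open>a\<close>
    arbitrary.\<close>
  have reach: "?safe t" if "(a, \<sigma> a) \<in> D" "x a \<in> safe_set X h a" "a \<le> t" "t < a + real n * dt"
    for n a
    using that
  proof (induction n arbitrary: a)
    case 0
    then show ?case by simp
  next
    case (Suc n)
    obtain \<delta> where \<delta>: "dt \<le> \<delta>" "\<And>s. s \<in> T \<Longrightarrow> a \<le> s \<Longrightarrow> s < a + \<delta> \<Longrightarrow> ?safe s"
      and nxt: "a + \<delta> \<in> T \<Longrightarrow> (a + \<delta>, \<sigma> (a + \<delta>)) \<in> D \<and> x (a + \<delta>) \<in> safe_set X h (a + \<delta>)"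
      using step[OF Suc.prems(1,2)] by blast
    show ?case
    proof (cases "t < a + \<delta>")
      case True
      then show ?thesis using \<delta>(2)[OF tT(1) Suc.prems(3)] by blast
    next
      case False
      have "a \<in> T"
        using Suc.prems(1) by (simp add: D_def impulse_opportunities_def sample_times_def)
      \<comment> \<open>The point lies between \<open>a\<close> and \<open>t\<close>, both in the
        interval \<open>T\<close>.\<close>
      then have "a + \<delta> \<in> T"
        using mem_is_interval_1_I[OF ivl _ tT(1)] False \<delta>(1) dt by simp
      moreover have "t < a + \<delta> + real n * dt"
        using Suc.prems(4) \<delta>(1) by (simp add: algebra_simps)
      ultimately show ?thesis
        using Suc.IH[of "a + \<delta>"] nxt False by auto
    qed
  qed
  have "t0 \<in> sample_times T t0 dt"
    using assms(3) by (auto simp: sample_times_def intro: exI[of _ "0::nat"])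
  then have start: "(t0, \<sigma> t0) \<in> D"
    using \<sigma>0 dt assms(5) by (simp add: D_def impulse_opportunities_def)
  obtain n :: nat where "(t - t0) / dt < real n"
    using reals_Archimedean2 by blast
  then have "t < t0 + real n * dt"
    using dt by (simp add: field_simps)
  then show "x t \<in> safe_set X h t \<and>
      post_state (impulse_opportunities T t0 dt dT) g u t (\<sigma> t) (x t) \<in> safe_set X h t"
    using reach[OF start x0 tT(2)] by (simp add: D_def)
qed

end
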